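(* Let $p$ be an even integer greater than $2$, let $k \geq 1$ be an integer, and let $D$ be an oriented graph of order $n\geq p+2$. Then $\mathrm{inv}^{= p}(D) \leq 2\,\mathrm{fas}(D) + 2pn$.
   Context: For an oriented graph $D$ and $X\subseteq V(D)$, the inversion of $X$ reverses the orientation of every arc with both endpoints in $X$. A $(=p)$-inversion is the inversion of a set of exactly $p$ vertices. $\mathrm{inv}^{=p}(D)$ is the minimum number of $(=p)$-inversions whose successive application makes $D$ acyclic ($+\infty$ if impossible). $\mathrm{fas}(D)$ is the minimum size of a set of arcs whose deletion makes $D$ acyclic. *)

theory Defs
  imports Main "HOL-Library.Extended_Nat"
begin

definition oriented_graph :: "'a set \<Rightarrow> ('a \<times> 'a) set \<Rightarrow> bool" where
  "oriented_graph V A \<longleftrightarrow> finite V \<and> A \<subseteq> V \<times> V \<and> asym A"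

definition inversion :: "'a set \<Rightarrow> ('a \<times> 'a) set \<Rightarrow> ('a \<times> 'a) set" where
  "inversion X A = {(u, v). if u \<in> X \<and> v \<in> X then (v, u) \<in> A else (u, v) \<in> A}"

text \<open>The infimum of the empty set in \<^typ>\<open>enat\<close> is infinity, which covers the case that
  no sequence of inversions makes the graph acyclic.\<close>

definition inv_eq :: "nat \<Rightarrow> 'a set \<Rightarrow> ('a \<times> 'a) set \<Rightarrow> enat" where
  "inv_eq p V A = Inf {enat (length Xs) |Xs.
     (\<forall>X\<in>set Xs. X \<subseteq> V \<and> card X = p) \<and> acyclic (fold inversion Xs A)}"

definition fas :: "('a \<times> 'a) set \<Rightarrow> nat" where
  "fas A = Inf {card F |F. F \<subseteq> A \<and> acyclic (A - F)}"

end

theory Submission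
  imports Defs
begin

text \<open>
  Inversions act on the edge set of the complete graph over \<open>GF(2)\<close>: inverting \<open>X\<close> adds the clique
  on \<open>X\<close>. A 4-cycle is a sum of four \<open>p\<close>-cliques and, as \<open>p\<close> is even, a path with two edges is
  a sum of \<open>2p - 2\<close> of them. Order the vertices as \<open>v\<^sub>1, \<dots>, v\<^sub>n\<^sub>-\<^sub>2, b, a\<close> with at most \<open>fas D\<close>
  backward arcs. For \<open>v = v\<^sub>1, \<dots>, v\<^sub>n\<^sub>-\<^sub>2\<close> in turn, cancel the remaining bad edges from \<open>v\<close> to
  vertices other than \<open>a\<close> in pairs by 4-cycles through \<open>v\<close> and \<open>a\<close>, at a cost of 2 per edge, and
  then use one path to clear what is left at \<open>v\<close>. New bad edges arise only at \<open>a\<close>,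
  so in the end at most \<open>ab\<close> is bad, and \<open>a\<close> and \<open>b\<close> can be swapped in the order.
\<close>

section \<open>Building blocks: 4-cycles and 2-edge paths as sums of
  \<open>p\<close>-cliques\<close>

text \<open>Singletons in \<open>T\<close> are irrelevant.\<close>

definition clique_sum :: "'a set \<Rightarrow> nat \<Rightarrow> nat \<Rightarrow> 'a set set \<Rightarrow> bool" where
  "clique_sum V p m T \<longleftrightarrow> (\<exists>Xs. length Xs \<le> m \<and> (\<forall>X\<in>set Xs. X \<subseteq> V \<and> card X = p) \<and>
     (\<forall>u v. u \<noteq> v \<longrightarrow> ({u, v} \<in> T \<longleftrightarrow> odd (length (filter (\<lambda>X. u \<in> X \<and> v \<in> X) Xs)))))"

lemma sym_diff_assoc: "sym_diff (sym_diff S T) U = sym_diff S (sym_diff T U)"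
  by blast

lemma clique_sum_empty: "clique_sum V p m {}"
  unfolding clique_sum_def by (rule exI[of _ "[]"]) simp

lemma clique_sum_mono: "clique_sum V p m T \<Longrightarrow> m \<le> m' \<Longrightarrow> clique_sum V p m' T"
  unfolding clique_sum_def by (meson order_trans)

lemma clique_sum_sym_diff:
  assumes "clique_sum V p m S" and "clique_sum V p k T"
  shows "clique_sum V p (m + k) (sym_diff S T)"
proof -
  obtain Xs where Xs: "length Xs \<le> m" "\<forall>X\<in>set Xs. X \<subseteq> V \<and> card X = p"
    "\<And>u v. u \<noteq> v \<Longrightarrow> {u, v} \<in> S \<longleftrightarrow> odd (length (filter (\<lambda>X. u \<in> X \<and> v \<in> X) Xs))"
    using assms(1) unfolding clique_sum_def by blast
  obtain Ys where Ys: "length Ys \<le> k" "\<forall>X\<in>set Ys. X \<subseteq> V \<and> card X = p"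
    "\<And>u v. u \<noteq> v \<Longrightarrow> {u, v} \<in> T \<longleftrightarrow> odd (length (filter (\<lambda>X. u \<in> X \<and> v \<in> X) Ys))"
    using assms(2) unfolding clique_sum_def by blast
  show ?thesis
    unfolding clique_sum_def
  proof (intro exI[of _ "Xs @ Ys"] conjI allI impI)
    show "length (Xs @ Ys) \<le> m + k" using Xs(1) Ys(1) by simp
    show "\<forall>X\<in>set (Xs @ Ys). X \<subseteq> V \<and> card X = p" using Xs(2) Ys(2) by auto
    fix u v :: 'a assume "u \<noteq> v"
    then show "{u, v} \<in> sym_diff S T
        \<longleftrightarrow> odd (length (filter (\<lambda>X. u \<in> X \<and> v \<in> X) (Xs @ Ys)))"
      using Xs(3)[of u v] Ys(3)[of u v] by auto
  qed
qed

text \<open>Edges inside \<open>Z\<close> lie in both cliques \<open>insert s Z\<close> and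
  \<open>insert t Z\<close> and cancel, while \<open>{s, t}\<close> lies in neither; only the two
  stars onto \<open>Z\<close> survive.\<close>

lemma clique_sum_two:
  assumes "finite V" "Z \<subseteq> V" "s \<in> V" "t \<in> V" "s \<notin> Z" "t \<notin> Z" "s \<noteq> t" "Suc (card Z) = p"
  shows "clique_sum V p 2 ((\<lambda>z. {s, z}) ` Z \<union> (\<lambda>z. {t, z}) ` Z)"
  unfolding clique_sum_def
proof (intro exI[of _ "[insert s Z, insert t Z]"] conjI allI impI)
  have "finite Z" using assms(1,2) finite_subset by blast
  then show "\<forall>X\<in>set [insert s Z, insert t Z]. X \<subseteq> V \<and> card X = p"
    using assms by auto
  fix u v :: 'a assume "u \<noteq> v"
  then show "{u, v} \<in> (\<lambda>z. {s, z}) ` Z \<union> (\<lambda>z. {t, z}) ` Z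
      \<longleftrightarrow> odd (length (filter (\<lambda>X. u \<in> X \<and> v \<in> X) [insert s Z, insert t Z]))"
    using assms(5-7) by (auto simp: image_iff doubleton_eq_iff)
qed simp

text \<open>Take \<open>Z\<close> to be \<open>insert x C\<close> and then \<open>insert y C\<close>
  in \<open>clique_sum_two\<close>: the edges from \<open>s\<close> and \<open>t\<close> to the
  common part \<open>C\<close> cancel. The \<open>p - 2\<close> vertices of \<open>C\<close> and the
  four of the cycle account for the bound \<open>p + 2\<close>.\<close>

lemma clique_sum_four_cycle:
  assumes "finite V" "card V \<ge> p + 2" "p \<ge> 2"
    and "{s, t, x, y} \<subseteq> V" "distinct [s, t, x, y]"
  shows "clique_sum V p 4 {{s, x}, {s, y}, {t, x}, {t, y}}"
proof -
  have "card (V - {s, t, x, y}) = card V - 4"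
    using assms by (subst card_Diff_subset) auto
  then have "p - 2 \<le> card (V - {s, t, x, y})" using assms(2) by simp
  then obtain C where C: "C \<subseteq> V - {s, t, x, y}" "card C = p - 2"
    by (meson obtain_subset_with_card_n)
  have "finite C" using C(1) assms(1) finite_subset by blast
  then have *: "clique_sum V p 2 ((\<lambda>z. {s, z}) ` insert w C \<union> (\<lambda>z. {t, z}) ` insert w C)"
    if "w \<in> {x, y}" for w
    using that C assms by (intro clique_sum_two) (auto simp: card_insert_if)
  have "sym_diff ((\<lambda>z. {s, z}) ` insert x C \<union> (\<lambda>z. {t, z}) ` insert x C)
      ((\<lambda>z. {s, z}) ` insert y C \<union> (\<lambda>z. {t, z}) ` insert y C)
      = {{s, x}, {s, y}, {t, x}, {t, y}}"
    using C(1) assms(5) by (auto simp: doubleton_eq_iff)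
  then show ?thesis
    using clique_sum_sym_diff[OF *[of x] *[of y]] by simp
qed

text \<open>Pairing up the vertices of \<open>W\<close> splits the biclique between
  \<open>{s, t}\<close> and \<open>W\<close> into \<open>m\<close> edge-disjoint 4-cycles, each
  costing 4.\<close>

lemma clique_sum_even_biclique:
  assumes "finite V" "card V \<ge> p + 2" "p \<ge> 2" "s \<in> V" "t \<in> V" "s \<noteq> t"
    and "W \<subseteq> V - {s, t}" "card W = 2 * m"
  shows "clique_sum V p (4 * m) ((\<lambda>z. {s, z}) ` W \<union> (\<lambda>z. {t, z}) ` W)"
  using assms(7,8)
proof (induction m arbitrary: W)
  case 0
  then have "W = {}" using assms(1) finite_subset[of W "V - {s, t}"] by auto
  then show ?case by (simp add: clique_sum_empty)
next
  case (Suc m)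
  then obtain x y U where U: "W = insert x (insert y U)" "x \<noteq> y" "x \<notin> U" "y \<notin> U" "card U = 2 * m"
    by (auto simp: card_Suc_eq)
  have "clique_sum V p (4 * m) ((\<lambda>z. {s, z}) ` U \<union> (\<lambda>z. {t, z}) ` U)"
    using Suc.IH[of U] Suc.prems U by auto
  moreover have "clique_sum V p 4 {{s, x}, {s, y}, {t, x}, {t, y}}"
    using clique_sum_four_cycle[of V p s t x y] assms Suc.prems U by auto
  moreover have "sym_diff ((\<lambda>z. {s, z}) ` U \<union> (\<lambda>z. {t, z}) ` U) {{s, x}, {s, y}, {t, x}, {t, y}}
      = (\<lambda>z. {s, z}) ` W \<union> (\<lambda>z. {t, z}) ` W"
    using U Suc.prems(1) assms(6) by (auto simp: doubleton_eq_iff)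
  ultimately have "clique_sum V p (4 * m + 4) ((\<lambda>z. {s, z}) ` W \<union> (\<lambda>z. {t, z}) ` W)"
    using clique_sum_sym_diff by metis
  then show ?case by (simp add: add.commute)
qed

text \<open>Two cliques give the biclique between \<open>{s, t}\<close> and
  \<open>insert c W\<close>. Since \<open>card W = p - 2\<close> is even, its part over
  \<open>W\<close> is a sum of 4-cycles and can be cancelled, leaving the two edges at
  \<open>c\<close>. With \<open>p = 2 * q + 2\<close> the cost is
  \<open>2 + 4 * q = 2 * p - 2\<close>.\<close>

lemma clique_sum_path:
  assumes "finite V" "card V \<ge> p + 2" "p \<ge> 2" "even p"
    and "{s, c, t} \<subseteq> V" "distinct [s, c, t]"
  shows "clique_sum V p (2 * p - 2) {{s, c}, {t, c}}"
proof -
  have "card (V - {s, t, c}) = card V - 3"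
    using assms by (subst card_Diff_subset) auto
  then have "p - 2 \<le> card (V - {s, t, c})" using assms(2) by simp
  then obtain W where W: "W \<subseteq> V - {s, t, c}" "card W = p - 2"
    by (meson obtain_subset_with_card_n)
  have "finite W" using W(1) assms(1) finite_subset by blast
  obtain q where q: "p = 2 * q + 2"
    using that[of "p div 2 - 1"] assms(3,4) by auto
  have "clique_sum V p 2 ((\<lambda>z. {s, z}) ` insert c W \<union> (\<lambda>z. {t, z}) ` insert c W)"
    using W \<open>finite W\<close> assms by (intro clique_sum_two) (auto simp: card_insert_if)
  moreover have "clique_sum V p (4 * q) ((\<lambda>z. {s, z}) ` W \<union> (\<lambda>z. {t, z}) ` W)"
    using W assms q by (intro clique_sum_even_biclique) auto
  moreover have "sym_diff ((\<lambda>z. {s, z}) ` insert c W \<union> (\<lambda>z. {t, z}) ` insert c W)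
      ((\<lambda>z. {s, z}) ` W \<union> (\<lambda>z. {t, z}) ` W) = {{s, c}, {t, c}}"
    using W(1) assms(6) by (auto simp: doubleton_eq_iff)
  ultimately have "clique_sum V p (2 + 4 * q) {{s, c}, {t, c}}"
    using clique_sum_sym_diff by metis
  then show ?thesis using q by simp
qed

section \<open>Clearing a set of edges down to at most one\<close>

definition edges_in :: "'a set \<Rightarrow> 'a set set" where
  "edges_in U = {{u, v} | u v. u \<in> U \<and> v \<in> U \<and> u \<noteq> v}"

lemma edges_in_iff: "{u, v} \<in> edges_in U \<longleftrightarrow> u \<in> U \<and> v \<in> U \<and> u \<noteq> v"
  by (auto simp: edges_in_def doubleton_eq_iff)

lemma finite_edges_in: "finite U \<Longrightarrow> finite (edges_in U)"
  by (rule finite_subset[of _ "Pow U"]) (auto simp: edges_in_def)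

text \<open>The bound charges 2 to each edge of \<open>T\<close> avoiding \<open>a\<close> and
  \<open>2 * p - 2\<close> to each vertex of \<open>vs\<close>. Edges at \<open>a\<close> are free,
  so corrections may create them. The outer induction removes the vertices of \<open>vs\<close> one
  by one; the inner one, on the number of edges avoiding \<open>a\<close>, removes pairs of edges at
  the current vertex.\<close>

lemma clique_sum_up_to_one_edge:
  assumes V: "finite V" "card V \<ge> p + 2" "p \<ge> 2" "even p"
    and "set (vs @ [b, a]) \<subseteq> V" "distinct (vs @ [b, a])"
    and "T \<subseteq> edges_in (set (vs @ [b, a]))"
  shows "\<exists>T'. clique_sum V p (2 * card {e \<in> T. a \<notin> e} + (2 * p - 2) * length vs) T' \<and>
    sym_diff T T' \<subseteq> {{a, b}}"
  using assms(5-7)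
proof (induction vs arbitrary: T)
  case Nil
  then have "T \<subseteq> {{a, b}}" by (auto simp: edges_in_def doubleton_eq_iff)
  then show ?case by (intro exI[of _ "{}"]) (auto simp: clique_sum_empty)
next
  case (Cons v vs)
  let ?U = "set (vs @ [b, a])" and ?L = "length vs"
  \<comment> \<open>Once a single sum \<open>S\<close> detaches \<open>v\<close>, the outer
    induction hypothesis finishes. The third condition says that \<open>S\<close> creates no edge
    avoiding \<open>a\<close>, so the charged count does not grow.\<close>
  have outer: "\<exists>T'. clique_sum V p (2 * card {e \<in> T. a \<notin> e} + (2 * p - 2) * length (v # vs)) T' \<and>
      sym_diff T T' \<subseteq> {{a, b}}"
    if S: "clique_sum V p (2 * p - 2) S" "sym_diff T S \<subseteq> edges_in ?U"
      "{e \<in> S. a \<notin> e} \<subseteq> T" "T \<subseteq> edges_in (set ((v # vs) @ [b, a]))" for S T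
  proof -
    let ?T = "sym_diff T S"
    obtain T' where T': "clique_sum V p (2 * card {e \<in> ?T. a \<notin> e} + (2 * p - 2) * ?L) T'"
      "sym_diff ?T T' \<subseteq> {{a, b}}"
      using Cons.IH[of ?T] Cons.prems(1,2) S(2) by auto
    have "finite T"
      using S(4) by (rule finite_subset) (simp add: finite_edges_in)
    then have "card {e \<in> ?T. a \<notin> e} \<le> card {e \<in> T. a \<notin> e}"
      using S(3) by (intro card_mono) auto
    then have "clique_sum V p (2 * card {e \<in> T. a \<notin> e} + (2 * p - 2) * length (v # vs)) (sym_diff S T')"
      by (intro clique_sum_mono[OF clique_sum_sym_diff[OF S(1) T'(1)]]) simp
    moreover have "sym_diff T (sym_diff S T') \<subseteq> {{a, b}}" using T'(2) by (simp only: sym_diff_assoc)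
    ultimately show ?thesis by blast
  qed
  show ?case
    using Cons.prems(3)
  proof (induction "card {e \<in> T. a \<notin> e}" arbitrary: T rule: less_induct)
    case less
    have dist: "v \<noteq> a" "v \<noteq> b" "a \<noteq> b" "v \<in> V" "a \<in> V" "b \<in> V" "v \<notin> set vs" "a \<notin> set vs"
      using Cons.prems by auto
    have fin: "finite T"
      using less.prems by (rule finite_subset) (simp add: finite_edges_in)
    \<comment> \<open>The neighbours of \<open>v\<close> along bad edges, apart from
      \<open>a\<close>; at least two of them allow a 4-cycle, otherwise one path suffices.\<close>
    define B where "B = {w. w \<noteq> a \<and> {v, w} \<in> T}"
    have BU: "w \<in> ?U \<and> w \<noteq> v \<and> w \<noteq> a \<and> w \<in> V" if "w \<in> B" for w
    proof -
      have "{v, w} \<in> edges_in (set ((v # vs) @ [b, a]))" "w \<noteq> a"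
        using that less.prems by (auto simp: B_def)
      then show ?thesis using Cons.prems(1) by (auto simp: edges_in_iff)
    qed
    have TU: "e \<in> edges_in ?U \<or> e = {v, a} \<or> (\<exists>w\<in>B. e = {v, w})" if "e \<in> T" for e
    proof -
      from that less.prems obtain x y where xy: "e = {x, y}" "x \<noteq> y" "x \<in> insert v ?U" "y \<in> insert v ?U"
        by (auto simp: edges_in_def)
      show ?thesis
      proof (cases "x = v \<or> y = v")
        case True
        then obtain w where "e = {v, w}" using xy(1) by blast
        then show ?thesis using that by (auto simp: B_def)
      next
        case False
        then show ?thesis using xy by (auto simp: edges_in_def)
      qed
    qed
    consider (two) w w' where "w \<in> B" "w' \<in> B" "w \<noteq> w'" | (one) w where "B = {w}" | (none) "B = {}"
      by blast
    then show ?case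
    proof cases
      case two
      \<comment> \<open>With \<open>v\<close> and \<open>a\<close> opposite on the cycle, the two
        edges at \<open>v\<close> disappear and the other two contain \<open>a\<close>. The cost 4
        is paid by the two charged edges removed.\<close>
      let ?S = "{{v, w}, {v, w'}, {a, w}, {a, w'}}"
      let ?T = "sym_diff T ?S"
      have w: "w \<in> ?U" "w \<noteq> v" "w \<noteq> a" "w \<in> V" "w' \<in> ?U" "w' \<noteq> v" "w' \<noteq> a" "w' \<in> V"
        "{v, w} \<in> T" "{v, w'} \<in> T"
        using BU two by (auto simp: B_def)
      have S: "clique_sum V p 4 ?S"
        using V w two(3) dist by (intro clique_sum_four_cycle) auto
      have eq: "{e \<in> ?T. a \<notin> e} = {e \<in> T. a \<notin> e} - {{v, w}, {v, w'}}"
        using w by auto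
      have sub: "{{v, w}, {v, w'}} \<subseteq> {e \<in> T. a \<notin> e}"
        using w dist by auto
      have c2: "card {{v, w}, {v, w'}} = 2"
        using two(3) by (auto simp: doubleton_eq_iff)
      have "card {e \<in> T. a \<notin> e} \<ge> 2"
        using card_mono[OF _ sub] fin c2 by simp
      moreover have "card {e \<in> ?T. a \<notin> e} = card {e \<in> T. a \<notin> e} - 2"
        unfolding eq using sub c2 by (subst card_Diff_subset) auto
      ultimately have card: "card {e \<in> T. a \<notin> e} = card {e \<in> ?T. a \<notin> e} + 2"
        by linarith
      have "?S \<subseteq> edges_in (set ((v # vs) @ [b, a]))"
        using w by (auto simp: edges_in_def)
      then have "?T \<subseteq> edges_in (set ((v # vs) @ [b, a]))" using less.prems by blast
      then obtain T' where T':
        "clique_sum V p (2 * card {e \<in> ?T. a \<notin> e} + (2 * p - 2) * length (v # vs)) T'"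
        "sym_diff ?T T' \<subseteq> {{a, b}}"
        using less.hyps[of ?T] card by auto
      have "clique_sum V p (2 * card {e \<in> T. a \<notin> e} + (2 * p - 2) * length (v # vs)) (sym_diff ?S T')"
        by (rule clique_sum_mono[OF clique_sum_sym_diff[OF S T'(1)]]) (simp add: card)
      moreover have "sym_diff T (sym_diff ?S T') \<subseteq> {{a, b}}" using T'(2) by (simp only: sym_diff_assoc)
      ultimately show ?thesis by blast
    next
      case one
      have w: "w \<in> ?U" "w \<noteq> v" "w \<noteq> a" "w \<in> V" "{v, w} \<in> T"
        using BU one by (auto simp: B_def)
      show ?thesis
      proof (cases "{v, a} \<in> T")
        \<comment> \<open>Both bad edges at \<open>v\<close> form a path centred at
          \<open>v\<close>, which removes them together.\<close>
        case True
        have "clique_sum V p (2 * p - 2) {{w, v}, {a, v}}"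
          using V w dist by (intro clique_sum_path) auto
        moreover have "sym_diff T {{w, v}, {a, v}} \<subseteq> edges_in ?U"
          using TU one True w(5) by (auto simp: insert_commute)
        ultimately show ?thesis
          using w less.prems by (intro outer) (auto simp: insert_commute)
      next
        \<comment> \<open>The path centred at \<open>w\<close> trades the bad edge
          \<open>{v, w}\<close> for a toggle of the free edge \<open>{a, w}\<close>.\<close>
        case False
        have "clique_sum V p (2 * p - 2) {{v, w}, {a, w}}"
          using V w dist by (intro clique_sum_path) auto
        moreover have "{a, w} \<in> edges_in ?U" using w by (auto simp: edges_in_def)
        then have "sym_diff T {{v, w}, {a, w}} \<subseteq> edges_in ?U"
          using TU one False w(5) by auto
        ultimately show ?thesis
          using w less.prems by (intro outer) auto
      qed
    next
      case none
      show ?thesis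
      proof (cases "{v, a} \<in> T")
        \<comment> \<open>The path centred at \<open>a\<close> moves the defect from
          \<open>{v, a}\<close> to \<open>{b, a}\<close>, still among the remaining
          vertices.\<close>
        case True
        have "clique_sum V p (2 * p - 2) {{v, a}, {b, a}}"
          using V dist by (intro clique_sum_path) auto
        moreover have "{b, a} \<in> edges_in ?U" using dist by (auto simp: edges_in_def)
        then have "sym_diff T {{v, a}, {b, a}} \<subseteq> edges_in ?U"
          using TU none True by auto
        ultimately show ?thesis
          using less.prems by (intro outer) auto
      next
        case False
        then have "sym_diff T {} \<subseteq> edges_in ?U" using TU none by auto
        then show ?thesis
          using less.prems by (intro outer[of "{}"]) (auto simp: clique_sum_empty)
      qed
    qed
  qed
qed

section \<open>From clique sums to inversions, and from acyclicity to vertex orders\<close>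

text \<open>Each set containing both endpoints swaps the orientation once, so only the parity
  recorded by \<open>clique_sum\<close> matters.\<close>

lemma fold_inversion:
  assumes "u \<noteq> v"
  shows "(u, v) \<in> fold inversion Xs A \<longleftrightarrow>
    (if odd (length (filter (\<lambda>X. u \<in> X \<and> v \<in> X) Xs)) then (v, u) \<in> A else (u, v) \<in> A)"
  using assms
proof (induction Xs arbitrary: A)
  case (Cons X Xs)
  then show ?case by (auto simp: inversion_def)
qed simp

lemma fold_inversion_diag: "(u, u) \<in> fold inversion Xs A \<longleftrightarrow> (u, u) \<in> A"
  by (induction Xs arbitrary: A) (auto simp: inversion_def)

text \<open>Topological sorting: a finite acyclic relation has a source, which is put first before
  recursing on the rest.\<close>

lemma acyclic_imp_sorted_wrt:
  assumes "finite V" "acyclic R"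
  shows "\<exists>xs. set xs = V \<and> distinct xs \<and> sorted_wrt (\<lambda>u v. (v, u) \<notin> R) xs"
  using assms(1)
proof (induction V rule: finite_remove_induct)
  case (remove U)
  have "wf (R \<inter> U \<times> U)"
    using remove(1) assms(2) by (intro finite_acyclic_wf) (auto intro: acyclic_subset)
  then obtain x where x: "x \<in> U" "\<And>y. y \<in> U \<Longrightarrow> (y, x) \<notin> R"
    using remove(2) unfolding wf_eq_minimal by (metis IntI SigmaI all_not_in_conv)
  obtain xs where "set xs = U - {x}" "distinct xs" "sorted_wrt (\<lambda>u v. (v, u) \<notin> R) xs"
    using remove.IH[OF x(1)] by blast
  then show ?case
    using x by (intro exI[of _ "x # xs"]) auto
qed simp

text \<open>No arc enters the first vertex \<open>x\<close>, so a cycle cannot pass through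
  \<open>x\<close> and survives when the arcs leaving \<open>x\<close> are dropped.\<close>

lemma sorted_wrt_imp_acyclic:
  assumes "R \<subseteq> set xs \<times> set xs" "irrefl R" "sorted_wrt (\<lambda>u v. (v, u) \<notin> R) xs"
  shows "acyclic R"
  using assms
proof (induction xs arbitrary: R)
  case Nil
  then show ?case by (simp add: acyclic_def)
next
  case (Cons x xs)
  have into_x: "(y, x) \<notin> R" for y
    using Cons.prems by (cases "y = x") (auto simp: irrefl_def)
  let ?R = "R \<inter> {y. y \<noteq> x} \<times> UNIV"
  have "acyclic ?R"
    using Cons.prems into_x by (intro Cons.IH) (auto simp: irrefl_def intro: sorted_wrt_mono_rel[rotated])
  have ne: "z \<noteq> x" if "(y, z) \<in> R\<^sup>+" for y z
    using that into_x by (metis tranclE)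
  have "(y, z) \<in> ?R\<^sup>+" if "(y, z) \<in> R\<^sup>+" "y \<noteq> x" for y z
    using that
  proof (induction rule: trancl_induct)
    case (step u z)
    then show ?case using ne[OF step(1)] by (auto intro: trancl_into_trancl)
  qed auto
  with \<open>acyclic ?R\<close> ne show ?case unfolding acyclic_def by blast
qed

theorem theorem4p9:
  fixes V :: "'a set" and A :: "('a \<times> 'a) set" and p k n :: nat
  assumes "even p" and "p > 2"
    and "k \<ge> 1"
    and "oriented_graph V A"
    and "card V = n"
    and "n \<ge> p + 2"
  shows "inv_eq p V A \<le> enat (2 * fas A + 2 * p * n)"
proof -
  have V: "finite V" "A \<subseteq> V \<times> V" "asym A"
    using assms(4) by (auto simp: oriented_graph_def)
  then have "finite A" using finite_subset by blast
  \<comment> \<open>Deleting all of \<open>A\<close> is always possible, so the infimum in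
    \<open>fas\<close> is attained.\<close>
  have "{card F |F. F \<subseteq> A \<and> acyclic (A - F)} \<noteq> {}"
    by (auto intro!: exI[of _ A] simp: acyclic_def)
  then have "fas A \<in> {card F |F. F \<subseteq> A \<and> acyclic (A - F)}"
    unfolding fas_def by (rule Inf_nat_def1)
  then obtain F where F: "F \<subseteq> A" "acyclic (A - F)" "card F = fas A"
    by auto
  obtain xs where xs: "set xs = V" "distinct xs" "sorted_wrt (\<lambda>u v. (v, u) \<notin> A - F) xs"
    using acyclic_imp_sorted_wrt[OF V(1) F(2)] by blast
  have len: "length xs = n" using xs assms(5) distinct_card by fastforce
  obtain ys a where "xs = ys @ [a]"
    using len assms(6) by (cases xs rule: rev_cases) auto
  moreover obtain vs b where "ys = vs @ [b]"
    using len assms(2,6) calculation by (cases ys rule: rev_cases) auto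
  ultimately have xs_eq: "xs = vs @ [b, a]" by simp
  \<comment> \<open>The backward arcs of the order \<open>xs\<close>, stored as unordered pairs; the
    positions recover their direction.\<close>
  define T where "T = {{xs ! j, xs ! i} | i j. i < j \<and> j < n \<and> (xs ! j, xs ! i) \<in> A}"
  have T_iff: "{xs ! i, xs ! j} \<in> T \<longleftrightarrow> (xs ! j, xs ! i) \<in> A" if "i < j" "j < n" for i j
  proof
    assume "{xs ! i, xs ! j} \<in> T"
    then obtain i' j' where ij: "{xs ! i, xs ! j} = {xs ! j', xs ! i'}" "i' < j'" "j' < n"
      "(xs ! j', xs ! i') \<in> A"
      unfolding T_def by blast
    have "i = i' \<and> j = j'"
      using ij(1-3) that xs(2) len by (auto simp: doubleton_eq_iff nth_eq_iff_index_eq)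
    then show "(xs ! j, xs ! i) \<in> A" using ij(4) by simp
  next
    assume "(xs ! j, xs ! i) \<in> A"
    then show "{xs ! i, xs ! j} \<in> T" using that unfolding T_def by (auto simp: insert_commute)
  qed
  \<comment> \<open>\<open>xs\<close> orders \<open>A - F\<close> forwards, so every backward arc
    lies in \<open>F\<close>; hence \<open>card T \<le> fas A\<close>.\<close>
  have "T \<subseteq> (\<lambda>(u, v). {u, v}) ` F"
  proof
    fix e assume "e \<in> T"
    then obtain i j where ij: "e = {xs ! j, xs ! i}" "i < j" "j < n" "(xs ! j, xs ! i) \<in> A"
      unfolding T_def by blast
    then have "(xs ! j, xs ! i) \<in> F"
      using xs(3) len by (auto simp: sorted_wrt_iff_nth_less)
    then show "e \<in> (\<lambda>(u, v). {u, v}) ` F" using ij(1) by force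
  qed
  moreover have "finite F" using F(1) \<open>finite A\<close> by (rule finite_subset)
  ultimately have "card T \<le> fas A" "finite T"
    using F(3) by (metis surj_card_le, metis finite_imageI finite_subset)
  then have card_T: "card {e \<in> T. a \<notin> e} \<le> fas A"
    using card_mono[of T "{e \<in> T. a \<notin> e}"] by auto
  have "T \<subseteq> edges_in (set (vs @ [b, a]))"
    using xs(2) len unfolding T_def edges_in_def xs_eq[symmetric]
    by (force simp: nth_eq_iff_index_eq)
  then obtain T' where T': "clique_sum V p (2 * card {e \<in> T. a \<notin> e} + (2 * p - 2) * length vs) T'"
    "sym_diff T T' \<subseteq> {{a, b}}"
    using clique_sum_up_to_one_edge[of V p vs b a T] V assms xs xs_eq by auto
  obtain Xs where Xs: "length Xs \<le> 2 * card {e \<in> T. a \<notin> e} + (2 * p - 2) * length vs"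
    "\<forall>X\<in>set Xs. X \<subseteq> V \<and> card X = p"
    "\<And>u v. u \<noteq> v \<Longrightarrow> {u, v} \<in> T' \<longleftrightarrow> odd (length (filter (\<lambda>X. u \<in> X \<and> v \<in> X) Xs))"
    using T'(1) unfolding clique_sum_def by blast
  define A' where "A' = fold inversion Xs A"
  have A'_iff: "(u, v) \<in> A' \<longleftrightarrow> (if {u, v} \<in> T' then (v, u) \<in> A else (u, v) \<in> A)" for u v
    using fold_inversion[of u v Xs A] fold_inversion_diag[of u Xs A] Xs(3)[of u v]
    unfolding A'_def by (cases "u = v") auto
  have "asym A'"
    using V(3) A'_iff by (auto simp: asym_iff insert_commute)
  \<comment> \<open>Off \<open>{a, b}\<close> the sets \<open>T\<close> and \<open>T'\<close> agree,
    so exactly the backward pairs get reversed.\<close>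
  have sorted: "sorted_wrt (\<lambda>u v. {u, v} \<noteq> {a, b} \<longrightarrow> (v, u) \<notin> A') xs"
    unfolding sorted_wrt_iff_nth_less
  proof (intro allI impI)
    fix i j assume ij: "i < j" "j < length xs" "{xs ! i, xs ! j} \<noteq> {a, b}"
    then have "{xs ! j, xs ! i} \<in> T' \<longleftrightarrow> (xs ! j, xs ! i) \<in> A"
      using T_iff[of i j] T'(2) len by (auto simp: insert_commute)
    then show "(xs ! j, xs ! i) \<notin> A'"
      using A'_iff[of "xs ! j" "xs ! i"] V(3) by (auto simp: asym_iff)
  qed
  have vs: "a \<notin> set vs" "b \<notin> set vs" using xs(2) xs_eq by auto
  \<comment> \<open>Swapping the adjacent last vertices \<open>b\<close> and \<open>a\<close>
    changes the relative order of no other pair, and \<open>asym A'\<close> rules out a backward arc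
    after the swap.\<close>
  have "sorted_wrt (\<lambda>u v. (v, u) \<notin> A') (if (a, b) \<in> A' then vs @ [a, b] else vs @ [b, a])"
  proof -
    have "sorted_wrt (\<lambda>u v. (v, u) \<notin> A') vs"
      using sorted vs unfolding xs_eq sorted_wrt_append
      by (auto elim!: sorted_wrt_mono_rel[rotated])
    then show ?thesis
      using sorted vs \<open>asym A'\<close> unfolding xs_eq
      by (auto simp: sorted_wrt_append asym_iff doubleton_eq_iff)
  qed
  moreover have "A' \<subseteq> V \<times> V" using A'_iff V(2) by (auto split: if_splits)
  moreover have "irrefl A'" using \<open>asym A'\<close> by (auto simp: asym_iff irrefl_def)
  ultimately have "acyclic A'"
    using xs(1) xs_eq by (intro sorted_wrt_imp_acyclic) auto
  then have "inv_eq p V A \<le> enat (length Xs)"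
    unfolding inv_eq_def using Xs(2) by (intro Inf_lower) (auto simp: A'_def)
  also have "length Xs \<le> 2 * fas A + 2 * p * n"
  proof -
    \<comment> \<open>Here \<open>length vs\<close> is \<open>n - 2\<close>, so the estimate is
      generous.\<close>
    have "(2 * p - 2) * length vs \<le> 2 * p * n"
      using len xs_eq by (intro mult_le_mono) auto
    then show ?thesis using Xs(1) card_T by linarith
  qed
  finally show ?thesis by simp
qed

end
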